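(* Let $X$ be a locally weakly systolic simplicial complex. Then $X$ is $7$-located.
   Context: All simplicial complexes considered are flag: any finite set of pairwise adjacent vertices spans a simplex. For distinct vertices write $v\sim v'$ if they are adjacent and $v\nsim v'$ otherwise. A subcomplex $L$ of $X$ is full if every simplex of $X$ whose vertices all lie in $L$ is contained in $L$. A cycle is a subcomplex isomorphic to a subdivision of the circle $S^1$, written $(v_1,\dots,v_k)$ with edges $\langle v_i,v_{i+1}\rangle$ (indices mod $k$); its length is its number of edges. A $k$-wheel $W=(v_0;v_1,\dots,v_k)$ is a subcomplex consisting of a cycle $(v_1,\dots,v_k)$ (its boundary $\partial W$) together with the triangles $\langle v_0,v_i,v_{i+1}\rangle$ (indices mod $k$), i.e. the cone on its boundary with center $v_0$. A $(k,l)$-dwheel $W=W_1\cup W_2$ is the union of two wheels $W_1=(w_l;v_1,v_2,\dots,v_k)$ and $W_2=(v_2;w_1,w_2,\dots,w_l)$ with $v_3=w_{l-1}$ and either $v_1=w_1$ (planar dwheel) or $v_1\sim w_1$ (nonplanar dwheel); its boundary $\partial W$ is the cycle $(w_1,w_2,\dots,w_{l-1}=v_3,v_4,\dots,v_k)$. The link $X_v$ of a vertex $v$ is the subcomplex of all simplices disjoint from $v$ that together with $v$ span a simplex. For $m\ge 4$, $X$ is $m$-located if it is flag and every dwheel $W=W_1\cup W_2$ in $X$ such that $\partial W$ has length at most $m$ and $W_1,W_2$ are full subcomplexes of $X$ is contained in the link $X_v$ of some vertex $v$. A flag complex is $k$-large if it has no full $j$-cycles with $4\le j\le k-1$. An extended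 $5$-wheel $(c;v_1,\dots,v_5;a)$ is a $5$-wheel $(c;v_1,\dots,v_5)$ together with a vertex $a$ spanning a triangle $\langle a,v_1,v_2\rangle$ and not adjacent to any other vertex of the $5$-wheel. A flag simplicial complex is locally weakly systolic if it is $5$-large and every extended $5$-wheel is contained in the link of some vertex. *)

theory Defs
  imports Main
begin

text \<open>An abstract simplicial complex is given by its set of nonempty simplices; its vertex set is
  the union of its simplices. It may be infinite.\<close>

definition simplicial_complex :: "'a set set \<Rightarrow> bool" where
  "simplicial_complex X \<longleftrightarrow>
     (\<forall>\<sigma>\<in>X. finite \<sigma> \<and> \<sigma> \<noteq> {} \<and> (\<forall>\<tau>. \<tau> \<subseteq> \<sigma> \<and> \<tau> \<noteq> {} \<longrightarrow> \<tau> \<in> X))"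

definition subcomplex :: "'a set set \<Rightarrow> 'a set set \<Rightarrow> bool" where
  "subcomplex L X \<longleftrightarrow> simplicial_complex L \<and> L \<subseteq> X"

definition full_subcomplex :: "'a set set \<Rightarrow> 'a set set \<Rightarrow> bool" where
  "full_subcomplex L X \<longleftrightarrow> subcomplex L X \<and> (\<forall>\<sigma>\<in>X. \<sigma> \<subseteq> \<Union>L \<longrightarrow> \<sigma> \<in> L)"

definition adjacent :: "'a set set \<Rightarrow> 'a \<Rightarrow> 'a \<Rightarrow> bool" where
  "adjacent X u v \<longleftrightarrow> u \<noteq> v \<and> {u, v} \<in> X"

definition flag_complex :: "'a set set \<Rightarrow> bool" where
  "flag_complex X \<longleftrightarrow> simplicial_complex X \<and>
     (\<forall>\<sigma>. finite \<sigma> \<and> \<sigma> \<noteq> {} \<and> \<sigma> \<subseteq> \<Union>X \<and>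
        (\<forall>u\<in>\<sigma>. \<forall>v\<in>\<sigma>. u \<noteq> v \<longrightarrow> adjacent X u v) \<longrightarrow> \<sigma> \<in> X)"

definition link :: "'a set set \<Rightarrow> 'a \<Rightarrow> 'a set set" where
  "link X v = {\<sigma> \<in> X. v \<notin> \<sigma> \<and> insert v \<sigma> \<in> X}"

definition faces :: "'a set \<Rightarrow> 'a set set" where
  "faces \<sigma> = {\<tau>. \<tau> \<subseteq> \<sigma> \<and> \<tau> \<noteq> {}}"


text \<open>The cycle \<open>(v\<^sub>1, \<dots>, v\<^sub>k)\<close> is encoded by the list of its vertices, so that
  \<open>v\<^sub>i\<close> is \<open>vs ! (i - 1)\<close> and the length of the list is the number of edges.\<close>

definition cycle_edges :: "'a list \<Rightarrow> 'a set set" where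
  "cycle_edges vs = {{vs ! i, vs ! (Suc i mod length vs)} | i. i < length vs}"

definition cycle_complex :: "'a list \<Rightarrow> 'a set set" where
  "cycle_complex vs = (\<Union>e\<in>cycle_edges vs. faces e)"

definition cycle_in :: "'a set set \<Rightarrow> 'a list \<Rightarrow> bool" where
  "cycle_in X vs \<longleftrightarrow> 3 \<le> length vs \<and> distinct vs \<and> subcomplex (cycle_complex vs) X"

definition wheel_complex :: "'a \<Rightarrow> 'a list \<Rightarrow> 'a set set" where
  "wheel_complex c vs = (\<Union>e\<in>cycle_edges vs. faces (insert c e))"

definition wheel_in :: "'a set set \<Rightarrow> 'a \<Rightarrow> 'a list \<Rightarrow> bool" where
  "wheel_in X c vs \<longleftrightarrow> cycle_in X vs \<and> c \<notin> set vs \<and> subcomplex (wheel_complex c vs) X"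


text \<open>In a dwheel, \<open>vs = (v\<^sub>1, \<dots>, v\<^sub>k)\<close> and \<open>ws = (w\<^sub>1, \<dots>, w\<^sub>l)\<close>; thus \<open>last ws\<close> is \<open>w\<^sub>l\<close>,
  \<open>vs ! 1\<close> is \<open>v\<^sub>2\<close>, \<open>vs ! 2\<close> is \<open>v\<^sub>3\<close> and \<open>ws ! (length ws - 2)\<close> is \<open>w\<close> with index \<open>l - 1\<close>.
  The two disjuncts are the planar and the nonplanar case.\<close>

definition dwheel_in :: "'a set set \<Rightarrow> 'a list \<Rightarrow> 'a list \<Rightarrow> bool" where
  "dwheel_in X vs ws \<longleftrightarrow>
     wheel_in X (last ws) vs \<and> wheel_in X (vs ! 1) ws \<and>
     vs ! 2 = ws ! (length ws - 2) \<and>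
     (hd vs = hd ws \<or> adjacent X (hd vs) (hd ws))"

definition dwheel_complex :: "'a list \<Rightarrow> 'a list \<Rightarrow> 'a set set" where
  "dwheel_complex vs ws = wheel_complex (last ws) vs \<union> wheel_complex (vs ! 1) ws"

text \<open>The boundary is \<open>(w\<^sub>1, \<dots>, w\<^bsub>l-1\<^esub> = v\<^sub>3, v\<^sub>4, \<dots>, v\<^sub>k)\<close>. For this to be a cycle, \<open>v\<^sub>k\<close> must be
  adjacent to \<open>w\<^sub>1\<close>. That is automatic in a planar dwheel, where \<open>w\<^sub>1 = v\<^sub>1\<close>, but not in a nonplanar
  one; if it fails there, the boundary closes up along \<open>v\<^sub>k, v\<^sub>1, w\<^sub>1\<close>. When both wheels are full
  in a flag complex, the list below is a cycle in \<open>X\<close>.\<close>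

definition dwheel_boundary :: "'a set set \<Rightarrow> 'a list \<Rightarrow> 'a list \<Rightarrow> 'a list" where
  "dwheel_boundary X vs ws =
     butlast ws @ drop 3 vs @ (if adjacent X (last vs) (hd ws) then [] else [hd vs])"

definition m_located :: "nat \<Rightarrow> 'a set set \<Rightarrow> bool" where
  "m_located m X \<longleftrightarrow> flag_complex X \<and>
     (\<forall>vs ws. dwheel_in X vs ws \<and> length (dwheel_boundary X vs ws) \<le> m \<and>
        full_subcomplex (wheel_complex (last ws) vs) X \<and>
        full_subcomplex (wheel_complex (vs ! 1) ws) X \<longrightarrow>
        (\<exists>v\<in>\<Union>X. dwheel_complex vs ws \<subseteq> link X v))"

definition k_large :: "nat \<Rightarrow> 'a set set \<Rightarrow> bool" where
  "k_large k X \<longleftrightarrow> flag_complex X \<and>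
     \<not> (\<exists>vs. cycle_in X vs \<and> full_subcomplex (cycle_complex vs) X \<and>
            4 \<le> length vs \<and> length vs < k)"

text \<open>The 5-wheel underlying an extended 5-wheel is not required to be full. That \<open>a\<close> is not a
  vertex of the wheel follows from the other conditions.\<close>

definition extended_5_wheel_in :: "'a set set \<Rightarrow> 'a \<Rightarrow> 'a list \<Rightarrow> 'a \<Rightarrow> bool" where
  "extended_5_wheel_in X c vs a \<longleftrightarrow>
     length vs = 5 \<and> wheel_in X c vs \<and>
     a \<noteq> vs ! 0 \<and> a \<noteq> vs ! 1 \<and> {a, vs ! 0, vs ! 1} \<in> X \<and>
     (\<forall>u \<in> insert c (set vs) - {vs ! 0, vs ! 1}. \<not> adjacent X a u)"

definition extended_5_wheel_complex :: "'a \<Rightarrow> 'a list \<Rightarrow> 'a \<Rightarrow> 'a set set" where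
  "extended_5_wheel_complex c vs a = wheel_complex c vs \<union> faces {a, vs ! 0, vs ! 1}"

definition locally_weakly_systolic :: "'a set set \<Rightarrow> bool" where
  "locally_weakly_systolic X \<longleftrightarrow> flag_complex X \<and> k_large 5 X \<and>
     (\<forall>c vs a. extended_5_wheel_in X c vs a \<longrightarrow>
        (\<exists>v\<in>\<Union>X. extended_5_wheel_complex c vs a \<subseteq> link X v))"

end

(*
Fullness and 5-largeness force both wheels to have length at least 5, so the boundary bound leaves
only the pairs (5,5), (5,6) and (6,5), the last two only if v_k is adjacent to w_1. Write p = w_l and
q = v_2 for the two centers. An edge from a v_i not adjacent to q to a w_j not adjacent to p would
close up to a full square through p and q, so these vertices are not adjacent. Hence a 5-wheel with
one of the centers, together with a vertex of the other wheel, is an extended 5-wheel. The vertex u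
dominating it is adjacent to the remaining vertices because there are no full squares, or else u
completes part of a wheel to a new 5-wheel, which again extends and whose dominating vertex works.
*)
theory Submission
  imports Defs
begin

section \<open>Full wheels and the two axioms in terms of the graph\<close>

text \<open>The trace of a full wheel on the 1-skeleton: the center sees the whole rim and the rim
  is an induced cycle. Rims of length 3 also fit this form, although a flag complex has no full
  3-wheel; they are excluded later at the level of complexes.\<close>

definition full_wheel :: "('a \<Rightarrow> 'a \<Rightarrow> bool) \<Rightarrow> 'a \<Rightarrow> 'a list \<Rightarrow> bool" where
  "full_wheel E c vs \<longleftrightarrow> distinct vs \<and> (\<forall>v\<in>set vs. E c v) \<and>
     (\<forall>i<length vs. \<forall>j<length vs. E (vs ! i) (vs ! j) \<longleftrightarrow>
        j = Suc i mod length vs \<or> i = Suc j mod length vs)"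

text \<open>\<open>v3 \<noteq> v5\<close> makes the five vertices distinct, as the remaining inequalities follow from the
  adjacencies to \<open>a\<close> and irreflexivity.\<close>

locale lws_graph =
  fixes E :: "'a \<Rightarrow> 'a \<Rightarrow> bool"
  assumes irrefl [simp]: "\<not> E u u"
    and sym: "E u v \<Longrightarrow> E v u"
    and no_square: "\<lbrakk>E u s; E u t; E m s; E m t; s \<noteq> t; \<not> E s t; u \<noteq> m\<rbrakk> \<Longrightarrow> E u m"
    and extended_5_wheel: "\<lbrakk>E c v1; E c v2; E c v3; E c v4; E c v5;
      E v1 v2; E v2 v3; E v3 v4; E v4 v5; E v5 v1; v3 \<noteq> v5; E a v1; E a v2;
      \<not> E a v3; \<not> E a v4; \<not> E a v5; \<not> E a c\<rbrakk> \<Longrightarrow> \<exists>z. \<forall>v\<in>{c, v1, v2, v3, v4, v5, a}. E z v"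
begin

lemma commute: "E u v \<longleftrightarrow> E v u"
  using sym by blast

lemma full_wheel_5:
  "full_wheel E c [v1, v2, v3, v4, v5] \<longleftrightarrow> distinct [v1, v2, v3, v4, v5] \<and>
     E c v1 \<and> E c v2 \<and> E c v3 \<and> E c v4 \<and> E c v5 \<and>
     E v1 v2 \<and> E v2 v3 \<and> E v3 v4 \<and> E v4 v5 \<and> E v5 v1 \<and>
     \<not> E v1 v3 \<and> \<not> E v1 v4 \<and> \<not> E v2 v4 \<and> \<not> E v2 v5 \<and> \<not> E v3 v5"
  by (auto simp: full_wheel_def All_less_Suc commute)

lemma full_wheel_6:
  "full_wheel E c [v1, v2, v3, v4, v5, v6] \<longleftrightarrow> distinct [v1, v2, v3, v4, v5, v6] \<and>
     E c v1 \<and> E c v2 \<and> E c v3 \<and> E c v4 \<and> E c v5 \<and> E c v6 \<and>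
     E v1 v2 \<and> E v2 v3 \<and> E v3 v4 \<and> E v4 v5 \<and> E v5 v6 \<and> E v6 v1 \<and>
     \<not> E v1 v3 \<and> \<not> E v1 v4 \<and> \<not> E v1 v5 \<and> \<not> E v2 v4 \<and> \<not> E v2 v5 \<and> \<not> E v2 v6 \<and>
     \<not> E v3 v5 \<and> \<not> E v3 v6 \<and> \<not> E v4 v6"
  by (auto simp: full_wheel_def All_less_Suc commute)

text \<open>The square u, s, m, t has the nonadjacent pair s, t, so u and m are adjacent or equal;
  the witness w separates them. This is how a newly found dominating vertex, which might coincide
  with m, is shown to see m.\<close>

lemma adjacent_by_witness:
  "\<lbrakk>E u s; E u t; E m s; E m t; s \<noteq> t; \<not> E s t; E u w; \<not> E m w\<rbrakk> \<Longrightarrow> E u m"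
  using no_square by metis

text \<open>Otherwise x, p, q, y would be a square with neither diagonal.\<close>

lemma not_adjacent_across:
  assumes "E p q" "E p x" "E q y" "\<not> E q x" "\<not> E p y" "x \<noteq> q" "y \<noteq> p"
  shows "\<not> E x y"
  using no_square[of x p y q] assms by (metis commute)

section \<open>Planar dwheels\<close>

text \<open>Here and below a = v_1, b = v_3 = w_(l-1) and, in the nonplanar case, c = w_1. The x are
  numbered backwards from v_k and the y forwards from w_2, so in the planar case \<open>x1\<close>
  and \<open>y1\<close> are the outer neighbours of a.\<close>

lemma planar_5_5:
  assumes W1: "full_wheel E p [a, q, b, x2, x1]" and W2: "full_wheel E q [a, y1, y2, b, p]"
  shows "\<exists>z. \<forall>v\<in>{p, q, a, b, x1, x2, y1, y2}. E z v"
proof -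
  note W = W1[unfolded full_wheel_5] W2[unfolded full_wheel_5]
  have "\<not> E y1 x1" "\<not> E y1 x2"
    using not_adjacent_across[of p q x1 y1] not_adjacent_across[of p q x2 y1] W by (auto simp: commute)
  \<comment> \<open>The wheel around p is extended by \<open>y1\<close> over its rim edge q,
    a.\<close>
  then obtain u where u: "\<forall>v\<in>{p, q, a, x1, x2, b, y1}. E u v"
    using extended_5_wheel[of p q a x1 x2 b y1] W by (auto simp: commute)
  \<comment> \<open>Square u, \<open>y1\<close>, \<open>y2\<close>, b with \<open>y1\<close>, b
    nonadjacent; u differs from \<open>y2\<close> because it sees p.\<close>
  have "E u y2"
    using no_square[of u y1 b y2] u W by (auto simp: commute)
  with u show ?thesis by auto
qed

lemma planar_5_6:
  assumes W1: "full_wheel E p [a, q, b, x2, x1]" and W2: "full_wheel E q [a, y1, y2, y3, b, p]"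
  shows "\<exists>z. \<forall>v\<in>{p, q, a, b, x1, x2, y1, y2, y3}. E z v"
proof -
  note W = W1[unfolded full_wheel_5] W2[unfolded full_wheel_6]
  have xy: "\<not> E x y" if "x \<in> {x1, x2}" "y \<in> {y1, y2, y3}" for x y
    using not_adjacent_across[of p q x y] W that by (auto simp: commute)
  then obtain u where u: "\<forall>v\<in>{p, q, a, x1, x2, b, y1}. E u v"
    using extended_5_wheel[of p q a x1 x2 b y1] W by (auto simp: commute)
  \<comment> \<open>On the path \<open>y1\<close>, \<open>y2\<close>, \<open>y3\<close>, b the
    vertex u sees both ends, so seeing one inner vertex forces the other by a square.\<close>
  have u_iff: "E u y2 \<longleftrightarrow> E u y3"
    using no_square[of u y2 b y3] no_square[of u y1 y3 y2] u W by (auto simp: commute)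
  show ?thesis
  proof (cases "E u y2")
    case True
    with u u_iff show ?thesis by auto
  next
    case False
    \<comment> \<open>In the rim around q, u replaces the consecutive vertices p, a, which leaves a
      5-wheel; \<open>x2\<close> extends it over the edge b, u.\<close>
    have "\<exists>z. \<forall>v\<in>{q, b, u, y1, y2, y3, x2}. E z v"
      using extended_5_wheel[of q b u y1 y2 y3 x2] u W xy by (auto simp: commute)
    then obtain z where z: "\<forall>v\<in>{q, b, u, y1, y2, y3, x2}. E z v" ..
    \<comment> \<open>The missing vertices p, a, \<open>x1\<close> are reached in this order: each
      has two nonadjacent neighbours already known to be adjacent to z.\<close>
    have zp: "E z p"
      using adjacent_by_witness[of z x2 q p y1] z W by (auto simp: commute)
    have za: "E z a"
      using adjacent_by_witness[of z y1 p a y2] z zp W by (auto simp: commute)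
    have "E z x1"
      using adjacent_by_witness[of z x2 a x1 q] z za W by (auto simp: commute)
    with z zp za show ?thesis by auto
  qed
qed

text \<open>Exchanging the two wheels and reversing both rims turns this into the (5,6)
  case.\<close>

lemma planar_6_5:
  assumes "full_wheel E p [a, q, b, x3, x2, x1]" and "full_wheel E q [a, y1, y2, b, p]"
  shows "\<exists>z. \<forall>v\<in>{p, q, a, b, x1, x2, x3, y1, y2}. E z v"
proof -
  have "full_wheel E q [a, p, b, y2, y1]" "full_wheel E p [a, x1, x2, x3, b, q]"
    using assms unfolding full_wheel_5 full_wheel_6 by (auto simp: commute)
  from planar_5_6[OF this] show ?thesis by auto
qed

section \<open>Nonplanar dwheels\<close>

lemma nonplanar_5_5:
  assumes W1: "full_wheel E p [a, q, b, x2, x1]" and W2: "full_wheel E q [c, y1, y2, b, p]"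
    and ac: "E a c"
  shows "\<exists>z. \<forall>v\<in>{p, q, a, b, c, x1, x2, y1, y2}. E z v"
proof -
  note W = W1[unfolded full_wheel_5] W2[unfolded full_wheel_5] ac
  have xy: "\<not> E x y" if "x \<in> {x1, x2}" "y \<in> {y1, y2}" for x y
    using not_adjacent_across[of p q x y] W that by (auto simp: commute)
  \<comment> \<open>Otherwise a, \<open>y2\<close>, b, p is a square without diagonals.\<close>
  have ay2: "\<not> E a y2"
    using no_square[of a y2 p b] W by (auto simp: commute)
  \<comment> \<open>The wheel around p is now extended by \<open>y2\<close> over the edge b, q:
    unlike in the planar case, nothing makes \<open>y1\<close> adjacent to a.\<close>
  then obtain u where u: "\<forall>v\<in>{p, b, q, a, x1, x2, y2}. E u v"
    using extended_5_wheel[of p b q a x1 x2 y2] W xy by (auto simp: commute)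
  have uc1: "E u c \<longleftrightarrow> E u y1"
    using no_square[of u c y2 y1] no_square[of u y1 p c] u W by (auto simp: commute)
  show ?thesis
  proof (cases "E u c")
    case True
    with u uc1 show ?thesis by auto
  next
    case False
    have "\<not> E c x1"
      using False no_square[of u x1 q c] u W by (auto simp: commute)
    \<comment> \<open>In the rim around q, the vertices b, p are replaced by u, a; \<open>x1\<close>
      extends this 5-wheel over the edge u, a.\<close>
    then have "\<exists>z. \<forall>v\<in>{q, u, a, c, y1, y2, x1}. E z v"
      using extended_5_wheel[of q u a c y1 y2 x1] u W xy by (auto simp: commute)
    then obtain z where z: "\<forall>v\<in>{q, u, a, c, y1, y2, x1}. E z v" ..
    have zp: "E z p"
      using adjacent_by_witness[of z x1 q p y1] z W by (auto simp: commute)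
    have zb: "E z b"
      using adjacent_by_witness[of z y2 p b a] z zp W by (auto simp: commute)
    have "E z x2"
      using adjacent_by_witness[of z x1 b x2 q] z zb W by (auto simp: commute)
    with z zp zb show ?thesis by auto
  qed
qed

text \<open>Since c sees \<open>x1\<close>, it can take the place of a in the wheel around p. The
  resulting dwheel is planar, and the vertex dominating it also sees a through \<open>x1\<close> and
  q.\<close>

lemma nonplanar_5_6:
  assumes W1: "full_wheel E p [a, q, b, x2, x1]" and W2: "full_wheel E q [c, y1, y2, y3, b, p]"
    and ac: "E a c" and cx: "E c x1"
  shows "\<exists>z. \<forall>v\<in>{p, q, a, b, c, x1, x2, y1, y2, y3}. E z v"
proof -
  note W = W1[unfolded full_wheel_5] W2[unfolded full_wheel_6] ac cx
  have "\<not> E c x2"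
    using no_square[of c x2 q b] W by (auto simp: commute)
  then have "full_wheel E p [c, q, b, x2, x1]"
    using W unfolding full_wheel_5 by (auto simp: commute)
  from planar_5_6[OF this W2] obtain u where u: "\<forall>v\<in>{p, q, c, b, x1, x2, y1, y2, y3}. E u v" ..
  have "E u a"
    using adjacent_by_witness[of u x1 q a b] u W by (auto simp: commute)
  with u show ?thesis by auto
qed

text \<open>Again c replaces a in the wheel around p. If c also sees \<open>x2\<close>, it bypasses
  \<open>x1\<close> as well and the planar dwheel is a (5,5) one, so both a and \<open>x1\<close>
  have to be recovered.\<close>

lemma nonplanar_6_5:
  assumes W1: "full_wheel E p [a, q, b, x3, x2, x1]" and W2: "full_wheel E q [c, y1, y2, b, p]"
    and ac: "E a c" and cx: "E c x1"
  shows "\<exists>z. \<forall>v\<in>{p, q, a, b, c, x1, x2, x3, y1, y2}. E z v"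
proof -
  note W = W1[unfolded full_wheel_6] W2[unfolded full_wheel_5] ac cx
  have cx3: "\<not> E c x3"
    using no_square[of c x3 q b] W by (auto simp: commute)
  show ?thesis
  proof (cases "E c x2")
    case False
    with cx3 have "full_wheel E p [c, q, b, x3, x2, x1]"
      using W unfolding full_wheel_6 by (auto simp: commute)
    from planar_6_5[OF this W2] obtain u
      where u: "\<forall>v\<in>{p, q, c, b, x1, x2, x3, y1, y2}. E u v" ..
    have "E u a"
      using adjacent_by_witness[of u x1 q a b] u W by (auto simp: commute)
    with u show ?thesis by auto
  next
    case True
    with cx3 have "full_wheel E p [c, q, b, x3, x2]"
      using W unfolding full_wheel_5 by (auto simp: commute)
    from planar_5_5[OF this W2] obtain u
      where u: "\<forall>v\<in>{p, q, c, b, x2, x3, y1, y2}. E u v" ..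
    \<comment> \<open>On the path q, a, \<open>x1\<close>, \<open>x2\<close> the vertex u sees both
      ends.\<close>
    have u_iff: "E u a \<longleftrightarrow> E u x1"
      using no_square[of u x1 q a] no_square[of u a x2 x1] u W by (auto simp: commute)
    show ?thesis
    proof (cases "E u a")
      case True
      with u u_iff show ?thesis by auto
    next
      case False
      have ay2: "\<not> E a y2"
        using no_square[of a y2 p b] W by (auto simp: commute)
      have xy: "\<not> E x y2" if "x \<in> {x1, x2, x3}" for x
        using not_adjacent_across[of p q x y2] W that by (auto simp: commute)
      \<comment> \<open>In the rim around p, u replaces b, \<open>x3\<close>; \<open>y2\<close>
        extends this 5-wheel over the edge q, u.\<close>
      have "\<exists>z. \<forall>v\<in>{p, q, u, x2, x1, a, y2}. E z v"
        using extended_5_wheel[of p q u x2 x1 a y2] ay2 u W xy by (auto simp: commute)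
      then obtain z where z: "\<forall>v\<in>{p, q, u, x2, x1, a, y2}. E z v" ..
      have zb: "E z b"
        using adjacent_by_witness[of z y2 p b a] z W by (auto simp: commute)
      have zx3: "E z x3"
        using adjacent_by_witness[of z x2 b x3 q] z zb W by (auto simp: commute)
      have zc: "E z c"
        using adjacent_by_witness[of z x2 q c y2] z \<open>E c x2\<close> W by (auto simp: commute)
      have "E z y1"
        using adjacent_by_witness[of z c y2 y1 p] z zc W by (auto simp: commute)
      with z zb zx3 zc show ?thesis by auto
    qed
  qed
qed

end

section \<open>Flag complexes, cycles and wheels\<close>

lemma simplicial_complex_face:
  "simplicial_complex X \<Longrightarrow> \<sigma> \<in> X \<Longrightarrow> \<tau> \<subseteq> \<sigma> \<Longrightarrow> \<tau> \<noteq> {} \<Longrightarrow> \<tau> \<in> X"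
  unfolding simplicial_complex_def by blast

lemma flag_complex_simplicial: "flag_complex X \<Longrightarrow> simplicial_complex X"
  by (simp add: flag_complex_def)

lemma flag_complex_clique:
  assumes "flag_complex X" "finite \<sigma>" "\<sigma> \<noteq> {}" "\<sigma> \<subseteq> \<Union>X"
    and "\<And>u v. u \<in> \<sigma> \<Longrightarrow> v \<in> \<sigma> \<Longrightarrow> u \<noteq> v \<Longrightarrow> adjacent X u v"
  shows "\<sigma> \<in> X"
  using assms unfolding flag_complex_def by blast

lemma adjacent_commute: "adjacent X u v \<longleftrightarrow> adjacent X v u"
  by (auto simp: adjacent_def insert_commute)

lemma adjacent_vertices: "adjacent X u v \<Longrightarrow> u \<in> \<Union>X \<and> v \<in> \<Union>X"
  by (auto simp: adjacent_def)

lemma simplex_adjacent: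
  assumes "simplicial_complex X" "\<sigma> \<in> X" "u \<in> \<sigma>" "v \<in> \<sigma>" "u \<noteq> v"
  shows "adjacent X u v"
  using simplicial_complex_face[OF assms(1,2), of "{u, v}"] assms by (auto simp: adjacent_def)

lemma flag_complex_triangle:
  assumes "flag_complex X" "adjacent X u v" "adjacent X u w" "adjacent X v w"
  shows "{u, v, w} \<in> X"
  using assms adjacent_vertices[OF assms(2)] adjacent_vertices[OF assms(3)]
  by (intro flag_complex_clique) (auto simp: adjacent_commute)

lemma subcomplex_Union_faces:
  assumes "simplicial_complex X" "\<And>e. e \<in> S \<Longrightarrow> f e \<in> X"
  shows "subcomplex (\<Union>e\<in>S. faces (f e)) X"
proof -
  let ?L = "\<Union>e\<in>S. faces (f e)"
  have sub: "?L \<subseteq> X"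
    using assms(2) simplicial_complex_face[OF assms(1)] by (auto simp: faces_def)
  have face: "\<tau> \<in> ?L" if \<sigma>: "\<sigma> \<in> ?L" and \<tau>: "\<tau> \<subseteq> \<sigma>" "\<tau> \<noteq> {}" for \<sigma> \<tau>
  proof -
    obtain e where "e \<in> S" "\<sigma> \<subseteq> f e"
      using \<sigma> unfolding faces_def by blast
    then have "\<tau> \<in> faces (f e)"
      using \<tau> by (auto simp: faces_def)
    with \<open>e \<in> S\<close> show ?thesis by blast
  qed
  have "finite \<sigma> \<and> \<sigma> \<noteq> {}" if "\<sigma> \<in> ?L" for \<sigma>
    using subsetD[OF sub that] assms(1) by (simp add: simplicial_complex_def)
  then have "simplicial_complex ?L"
    unfolding simplicial_complex_def using face by blast
  with sub show ?thesis
    by (simp add: subcomplex_def)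
qed

lemma cycle_edges_image:
  "cycle_edges vs = (\<lambda>i. {vs ! i, vs ! (Suc i mod length vs)}) ` {..<length vs}"
  unfolding cycle_edges_def by blast

lemma cycle_edges_4: "cycle_edges [a, b, c, d] = {{a, b}, {b, c}, {c, d}, {d, a}}"
  by (auto simp: cycle_edges_image lessThan_Suc)

lemma cycle_edges_5: "cycle_edges [a, b, c, d, e] = {{a, b}, {b, c}, {c, d}, {d, e}, {e, a}}"
  by (auto simp: cycle_edges_image lessThan_Suc)

lemma Union_cycle_edges: "\<Union>(cycle_edges vs) = set vs"
proof -
  have "vs ! (Suc i mod length vs) \<in> set vs" if "i < length vs" for i
    using that by (intro nth_mem mod_less_divisor) auto
  then show ?thesis
    by (auto simp: cycle_edges_image in_set_conv_nth)
qed

lemma Union_wheel_complex: "vs \<noteq> [] \<Longrightarrow> \<Union>(wheel_complex c vs) = insert c (set vs)"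
proof -
  assume "vs \<noteq> []"
  moreover have "\<Union>(wheel_complex c vs) = (\<Union>e\<in>cycle_edges vs. insert c e)"
    by (auto simp: wheel_complex_def faces_def)
  ultimately show ?thesis
    using Union_cycle_edges[of vs] by (auto simp: cycle_edges_image)
qed

lemma no_full_4_cycle:
  assumes X: "k_large 5 X" and adj: "adjacent X a b" "adjacent X b c" "adjacent X c d" "adjacent X d a"
    and ne: "a \<noteq> c" "b \<noteq> d" and nac: "\<not> adjacent X a c"
  shows "adjacent X b d"
proof (rule ccontr)
  assume nbd: "\<not> adjacent X b d"
  have sX: "simplicial_complex X"
    using X by (simp add: k_large_def flag_complex_simplicial)
  let ?vs = "[a, b, c, d]" and ?L = "cycle_complex [a, b, c, d]"
  have sub: "subcomplex ?L X"
    unfolding cycle_complex_def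
    by (rule subcomplex_Union_faces[OF sX, of _ "\<lambda>e. e"]) (use adj in \<open>auto simp: cycle_edges_4 adjacent_def\<close>)
  have "\<sigma> \<in> ?L" if "\<sigma> \<in> X" "\<sigma> \<subseteq> \<Union>?L" for \<sigma>
  proof -
    have "\<sigma> \<noteq> {}"
      using sX that by (auto simp: simplicial_complex_def)
    moreover have "\<sigma> \<subseteq> {a, b, c, d}"
      using that by (auto simp: cycle_complex_def cycle_edges_4 faces_def)
    \<comment> \<open>A simplex on these vertices omits one of each opposite pair, so it lies in an
      edge of the cycle.\<close>
    moreover have "\<not> (a \<in> \<sigma> \<and> c \<in> \<sigma>)" "\<not> (b \<in> \<sigma> \<and> d \<in> \<sigma>)"
      using simplex_adjacent[OF sX that(1)] ne nac nbd by blast+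
    ultimately show ?thesis
      unfolding cycle_complex_def cycle_edges_4 faces_def by auto
  qed
  then have "full_subcomplex ?L X"
    using sub by (simp add: full_subcomplex_def)
  moreover have "cycle_in X ?vs"
    using sub adj ne by (auto simp: cycle_in_def adjacent_def)
  ultimately show False
    using X by (force simp: k_large_def)
qed

lemma wheel_in_5:
  assumes X: "flag_complex X"
    and c: "\<forall>v\<in>{v1, v2, v3, v4, v5}. adjacent X c v"
    and cyc: "adjacent X v1 v2" "adjacent X v2 v3" "adjacent X v3 v4" "adjacent X v4 v5"
      "adjacent X v5 v1"
    and dist: "distinct [v1, v2, v3, v4, v5]"
  shows "wheel_in X c [v1, v2, v3, v4, v5]"
proof -
  note sX = flag_complex_simplicial[OF X]
  have "subcomplex (cycle_complex [v1, v2, v3, v4, v5]) X"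
    unfolding cycle_complex_def
    by (rule subcomplex_Union_faces[OF sX, of _ "\<lambda>e. e"]) (use cyc in \<open>auto simp: cycle_edges_5 adjacent_def\<close>)
  moreover have "subcomplex (wheel_complex c [v1, v2, v3, v4, v5]) X"
    unfolding wheel_complex_def
    by (rule subcomplex_Union_faces[OF sX])
      (use c cyc in \<open>auto simp: cycle_edges_5 intro!: flag_complex_triangle[OF X]\<close>)
  moreover have "c \<notin> {v1, v2, v3, v4, v5}"
    using c by (auto simp: adjacent_def)
  ultimately show ?thesis
    using dist by (simp add: wheel_in_def cycle_in_def)
qed

lemma link_adjacent:
  assumes "simplicial_complex X" "L \<subseteq> link X z" "v \<in> \<Union>L"
  shows "adjacent X z v"
proof -
  obtain \<sigma> where "\<sigma> \<in> L" "v \<in> \<sigma>" using assms by blast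
  then have "insert z \<sigma> \<in> X" "z \<notin> \<sigma>" using assms by (auto simp: link_def)
  then show ?thesis
    using simplex_adjacent[OF assms(1), of "insert z \<sigma>" z v] \<open>v \<in> \<sigma>\<close> by auto
qed

text \<open>By flagness, seeing all vertices of a simplex suffices to span a simplex with it. Hence
  containment in a link is a question about the graph only.\<close>

lemma subcomplex_link:
  assumes X: "flag_complex X" and L: "L \<subseteq> X" and z: "\<And>v. v \<in> \<Union>L \<Longrightarrow> adjacent X z v"
  shows "L \<subseteq> link X z"
proof
  fix \<sigma> assume "\<sigma> \<in> L"
  note sX = flag_complex_simplicial[OF X]
  have \<sigma>: "\<sigma> \<in> X" "finite \<sigma>" "\<sigma> \<noteq> {}"
    using \<open>\<sigma> \<in> L\<close> L sX by (auto simp: simplicial_complex_def)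
  have adj: "adjacent X z v" if "v \<in> \<sigma>" for v
    using that z \<open>\<sigma> \<in> L\<close> by blast
  have "insert z \<sigma> \<in> X"
  proof (rule flag_complex_clique[OF X])
    show "insert z \<sigma> \<subseteq> \<Union>X"
      using adj adjacent_vertices[of X z] \<sigma> by blast
    show "adjacent X u v" if "u \<in> insert z \<sigma>" "v \<in> insert z \<sigma>" "u \<noteq> v" for u v
      using that adj simplex_adjacent[OF sX \<sigma>(1)] by (auto simp: adjacent_commute[of X u z])
  qed (use \<sigma> in auto)
  moreover have "z \<notin> \<sigma>"
    using adj by (auto simp: adjacent_def)
  ultimately show "\<sigma> \<in> link X z"
    using \<sigma> by (simp add: link_def)
qed

section \<open>Passage between complexes and graphs\<close>

text \<open>The square axiom is 5-largeness applied to the cycle s, u, t, m; the other one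
  translates links of extended 5-wheels into dominating vertices.\<close>

lemma locally_weakly_systolic_graph:
  assumes X: "locally_weakly_systolic X"
  shows "lws_graph (adjacent X)"
proof
  have flag: "flag_complex X" and large: "k_large 5 X"
    using X by (auto simp: locally_weakly_systolic_def)
  note sX = flag_complex_simplicial[OF flag]
  show "\<not> adjacent X u u" for u
    by (simp add: adjacent_def)
  show "adjacent X v u" if "adjacent X u v" for u v
    using that by (simp add: adjacent_commute)
  show "adjacent X u m" if "adjacent X u s" "adjacent X u t" "adjacent X m s" "adjacent X m t"
    "s \<noteq> t" "\<not> adjacent X s t" "u \<noteq> m" for u s t m
    using no_full_4_cycle[OF large, of s u t m] that by (simp add: adjacent_commute)
  show "\<exists>z. \<forall>v\<in>{c, v1, v2, v3, v4, v5, a}. adjacent X z v"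
    if c: "adjacent X c v1" "adjacent X c v2" "adjacent X c v3" "adjacent X c v4" "adjacent X c v5"
      and cyc: "adjacent X v1 v2" "adjacent X v2 v3" "adjacent X v3 v4" "adjacent X v4 v5"
        "adjacent X v5 v1"
      and ne: "v3 \<noteq> v5"
      and a: "adjacent X a v1" "adjacent X a v2" "\<not> adjacent X a v3" "\<not> adjacent X a v4"
        "\<not> adjacent X a v5" "\<not> adjacent X a c"
    for c v1 v2 v3 v4 v5 a
  proof -
    let ?vs = "[v1, v2, v3, v4, v5]"
    have dist: "distinct ?vs"
      using cyc ne a by (auto simp: adjacent_def)
    have "wheel_in X c ?vs"
      using wheel_in_5[OF flag _ cyc dist] c by simp
    moreover have "{a, v1, v2} \<in> X"
      using flag_complex_triangle[OF flag a(1,2) cyc(1)] .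
    ultimately have "extended_5_wheel_in X c ?vs a"
      using a by (auto simp: extended_5_wheel_in_def adjacent_def)
    then obtain z where z: "extended_5_wheel_complex c ?vs a \<subseteq> link X z"
      using X unfolding locally_weakly_systolic_def by blast
    have "\<Union>(extended_5_wheel_complex c ?vs a) = {c, v1, v2, v3, v4, v5, a}"
      using Union_wheel_complex[of ?vs c]
      by (auto simp: extended_5_wheel_complex_def faces_def)
    then show ?thesis
      using link_adjacent[OF sX z] by blast
  qed
qed

lemma full_wheel_adjacent:
  assumes X: "flag_complex X" and W: "wheel_in X c vs"
    and full: "full_subcomplex (wheel_complex c vs) X"
  shows "full_wheel (adjacent X) c vs"
proof -
  let ?n = "length vs"
  note sX = flag_complex_simplicial[OF X]
  have n: "3 \<le> ?n" and dist: "distinct vs" and c: "c \<notin> set vs"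
    and sub: "wheel_complex c vs \<subseteq> X"
    using W by (auto simp: wheel_in_def cycle_in_def subcomplex_def)
  have U: "\<Union>(wheel_complex c vs) = insert c (set vs)"
    using n by (intro Union_wheel_complex) auto
  have lt: "Suc i mod ?n < ?n" for i
    using n by (intro mod_less_divisor) auto
  have e: "insert c e \<in> X" if "e \<in> cycle_edges vs" for e
    using that sub by (auto simp: wheel_complex_def faces_def)
  have center: "adjacent X c v" if "v \<in> set vs" for v
  proof -
    obtain e where "e \<in> cycle_edges vs" "v \<in> e"
      using \<open>v \<in> set vs\<close> Union_cycle_edges[of vs] by blast
    then show ?thesis
      using simplex_adjacent[OF sX e, of e c v] c \<open>v \<in> set vs\<close> by auto
  qed
  have edge: "adjacent X (vs ! i) (vs ! (Suc i mod ?n))" if "i < ?n" for i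
  proof (rule simplex_adjacent[OF sX e])
    show "{vs ! i, vs ! (Suc i mod ?n)} \<in> cycle_edges vs"
      using that by (auto simp: cycle_edges_def)
    have "i \<noteq> Suc i mod ?n"
      using that n by (cases "Suc i = ?n") auto
    then show "vs ! i \<noteq> vs ! (Suc i mod ?n)"
      using that dist lt by (simp add: nth_eq_iff_index_eq)
  qed auto
  have "j = Suc i mod ?n \<or> i = Suc j mod ?n"
    if ij: "i < ?n" "j < ?n" and adj: "adjacent X (vs ! i) (vs ! j)" for i j
  proof -
    \<comment> \<open>Fullness puts the edge into a triangle of the wheel. Neither end is c, so both
      ends lie on one rim edge.\<close>
    have "{vs ! i, vs ! j} \<in> wheel_complex c vs"
      using full adj ij U by (auto simp: full_subcomplex_def adjacent_def)
    then obtain m where m: "m < ?n"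
      "{vs ! i, vs ! j} \<subseteq> insert c {vs ! m, vs ! (Suc m mod ?n)}"
      by (auto simp: wheel_complex_def cycle_edges_def faces_def)
    have "vs ! i \<noteq> c" "vs ! j \<noteq> c" "vs ! i \<noteq> vs ! j"
      using c ij adj by (auto simp: adjacent_def)
    with m(2) have "i \<in> {m, Suc m mod ?n}" "j \<in> {m, Suc m mod ?n}" "i \<noteq> j"
      using dist ij m(1) lt by (auto simp: nth_eq_iff_index_eq)
    then show ?thesis by auto
  qed
  then show ?thesis
    using dist center edge adjacent_commute[of X] unfolding full_wheel_def by blast
qed

text \<open>A rim of length 3 spans a simplex by flagness, which fullness would put into the wheel,
  but every triangle of the wheel contains c. A rim of length 4 would be a full square.\<close>

lemma full_wheel_length:
  assumes X: "k_large 5 X" and W: "wheel_in X c vs"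
    and full: "full_subcomplex (wheel_complex c vs) X"
  shows "5 \<le> length vs"
proof (rule ccontr)
  have flag: "flag_complex X"
    using X by (simp add: k_large_def)
  have n: "3 \<le> length vs"
    using W by (auto simp: wheel_in_def cycle_in_def)
  note fw = full_wheel_adjacent[OF flag W full]
  assume "\<not> 5 \<le> length vs"
  with n consider "length vs = 3" | "length vs = 4" by linarith
  then show False
  proof cases
    case 1
    then obtain a b d where vs: "vs = [a, b, d]"
      by (auto simp: numeral_eq_Suc length_Suc_conv)
    have "adjacent X a b" "adjacent X a d" "adjacent X b d"
      using fw by (auto simp: vs full_wheel_def All_less_Suc)
    then have "{a, b, d} \<in> wheel_complex c vs"
      using full flag_complex_triangle[OF flag] Union_wheel_complex[of vs c]
      by (auto simp: full_subcomplex_def vs)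
    moreover have "distinct [a, b, d]" "c \<notin> {a, b, d}"
      using W by (auto simp: wheel_in_def cycle_in_def vs)
    ultimately show False
      by (auto simp: wheel_complex_def vs cycle_edges_image lessThan_Suc faces_def)
  next
    case 2
    then obtain a b d e where vs: "vs = [a, b, d, e]"
      by (auto simp: numeral_eq_Suc length_Suc_conv)
    have "distinct [a, b, d, e]" "adjacent X a b" "adjacent X b d" "adjacent X d e" "adjacent X e a"
      "\<not> adjacent X a d" "\<not> adjacent X b e"
      using fw by (auto simp: vs full_wheel_def All_less_Suc)
    then show False
      using no_full_4_cycle[OF X, of a b d e] by auto
  qed
qed

section \<open>Reduction to the three pairs of lengths\<close>

lemma length_eq_5: "length xs = 5 \<Longrightarrow> \<exists>a b c d e. xs = [a, b, c, d, e]"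
  by (auto simp: numeral_eq_Suc length_Suc_conv)

lemma length_eq_6: "length xs = 6 \<Longrightarrow> \<exists>a b c d e f. xs = [a, b, c, d, e, f]"
  by (auto simp: numeral_eq_Suc length_Suc_conv)

theorem theorem3p1:
  fixes X :: "'a set set"
  assumes "locally_weakly_systolic X"
  shows "m_located 7 X"
proof -
  have flag: "flag_complex X" and large: "k_large 5 X"
    using assms by (auto simp: locally_weakly_systolic_def)
  interpret lws_graph "adjacent X"
    using assms by (rule locally_weakly_systolic_graph)
  have "\<exists>z\<in>\<Union>X. dwheel_complex vs ws \<subseteq> link X z"
    if W: "dwheel_in X vs ws" and len: "length (dwheel_boundary X vs ws) \<le> 7"
      and full: "full_subcomplex (wheel_complex (last ws) vs) X"
        "full_subcomplex (wheel_complex (vs ! 1) ws) X" for vs ws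
  proof -
    have W1: "wheel_in X (last ws) vs" and W2: "wheel_in X (vs ! 1) ws"
      and b: "vs ! 2 = ws ! (length ws - 2)" and ac: "hd vs = hd ws \<or> adjacent X (hd vs) (hd ws)"
      using W by (auto simp: dwheel_in_def)
    note F1 = full_wheel_adjacent[OF flag W1 full(1)]
      and F2 = full_wheel_adjacent[OF flag W2 full(2)]
    have n: "5 \<le> length vs" "5 \<le> length ws"
      using full_wheel_length[OF large] W1 W2 full by blast+
    \<comment> \<open>The boundary omits \<open>last ws\<close> and the first three entries of
      \<open>vs\<close>, so it has 4 vertices fewer than the two rims together, plus
      \<open>hd vs\<close> if it does not close up directly.\<close>
    have l: "length ws + length vs + (if adjacent X (last vs) (hd ws) then 0 else 1) \<le> 11"
      using len n by (auto simp: dwheel_boundary_def)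
    then consider "length vs = 5" "length ws = 5"
      | "length vs = 5" "length ws = 6" "adjacent X (last vs) (hd ws)"
      | "length vs = 6" "length ws = 5" "adjacent X (last vs) (hd ws)"
      using n by (cases "adjacent X (last vs) (hd ws)"; simp; linarith)
    then have "\<exists>z. \<forall>v\<in>{last ws, vs ! 1} \<union> set vs \<union> set ws. adjacent X z v"
    proof cases
      case 1
      then obtain a q b x2 x1 c y1 y2 b' p where
        vs: "vs = [a, q, b, x2, x1]" and ws: "ws = [c, y1, y2, b', p]"
        by (meson length_eq_5)
      \<comment> \<open>The fact \<open>b\<close> identifies \<open>b'\<close> with
        \<open>b\<close>; the two alternatives in \<open>ac\<close> select the planar lemma, with c
        = a, or the nonplanar one.\<close>
      show ?thesis
        using planar_5_5[of p a q b x2 x1 y1 y2] nonplanar_5_5[of p a q b x2 x1 c y1 y2] F1 F2 b ac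
        unfolding vs ws by auto
    next
      case 2
      then obtain a q b x2 x1 c y1 y2 y3 b' p where
        vs: "vs = [a, q, b, x2, x1]" and ws: "ws = [c, y1, y2, y3, b', p]"
        by (meson length_eq_5 length_eq_6)
      show ?thesis
        using planar_5_6[of p a q b x2 x1 y1 y2 y3] nonplanar_5_6[of p a q b x2 x1 c y1 y2 y3]
          F1 F2 b ac 2(3) unfolding vs ws by (auto simp: commute)
    next
      case 3
      then obtain a q b x3 x2 x1 c y1 y2 b' p where
        vs: "vs = [a, q, b, x3, x2, x1]" and ws: "ws = [c, y1, y2, b', p]"
        by (meson length_eq_5 length_eq_6)
      show ?thesis
        using planar_6_5[of p a q b x3 x2 x1 y1 y2] nonplanar_6_5[of p a q b x3 x2 x1 c y1 y2]
          F1 F2 b ac 3(3) unfolding vs ws by (auto simp: commute)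
    qed
    then obtain z where z: "\<forall>v\<in>{last ws, vs ! 1} \<union> set vs \<union> set ws. adjacent X z v" ..
    have "\<Union>(dwheel_complex vs ws) = {last ws, vs ! 1} \<union> set vs \<union> set ws"
    proof -
      have "vs \<noteq> []" "ws \<noteq> []"
        using n by auto
      then show ?thesis
        unfolding dwheel_complex_def Union_Un_distrib by (auto simp: Union_wheel_complex)
    qed
    moreover have "dwheel_complex vs ws \<subseteq> X"
      using full by (auto simp: dwheel_complex_def full_subcomplex_def subcomplex_def)
    ultimately have "dwheel_complex vs ws \<subseteq> link X z"
      using z by (intro subcomplex_link[OF flag]) auto
    moreover have "z \<in> \<Union>X"
      using z adjacent_vertices[of X z] by blast
    ultimately show ?thesis by blast
  qed
  then show ?thesis
    using flag unfolding m_located_def by blast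
qed

end
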